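(* Every loop in the real projective plane $\mathbb{R}\mathrm{P}^2$ is quantum nullhomotopic.
   Context: $S^1$ is the unit circle, $D^2$ is the unit disk, and $j\colon S^1\hookrightarrow D^2$ is the inclusion map. For a compact Hausdorff space $X$, $C(X)$ is the C*-algebra of continuous complex-valued functions on $X$, and for a continuous map $g\colon X \to Y$, $g^\star\colon C(Y)\to C(X)$ is $a\mapsto a\circ g$. A loop in a compact Hausdorff space $T$ is a continuous function $f\colon S^1\to T$. A loop $f$ in $T$ is quantum nullhomotopic if there is a nonzero finite-dimensional (complex) Hilbert space $H$ and a unital $*$-homomorphism $\phi\colon C(T)\to C(D^2)\otimes L(H)$ such that $(j^\star\otimes\mathrm{id})(\phi(a)) = f^\star(a)\otimes 1_H$ for all $a\in C(T)$, where $L(H)$ is the C*-algebra of linear operators on $H$ and $\otimes$ is the tensor product of C*-algebras. *)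

theory Defs
  imports
    "HOL-Analysis.Analysis"
    "Jordan_Normal_Form.Schur_Decomposition"
begin

record 'a star_algebra = "(complex, 'a) module" +
  adj :: "'a \<Rightarrow> 'a"

definition unital_star_hom ::
  "('a, 'm) star_algebra_scheme \<Rightarrow> ('b, 'n) star_algebra_scheme \<Rightarrow> ('a \<Rightarrow> 'b) \<Rightarrow> bool"
where
  "unital_star_hom A B \<phi> \<longleftrightarrow>
     \<phi> \<in> Ring.ring_hom A B \<and>
     (\<forall>c. \<forall>a\<in>carrier A. \<phi> (c \<odot>\<^bsub>A\<^esub> a) = c \<odot>\<^bsub>B\<^esub> \<phi> a) \<and>
     (\<forall>a\<in>carrier A. \<phi> (adj A a) = adj B (\<phi> a))"


section \<open>The algebras \<open>C(X)\<close>, \<open>L(H)\<close> and \<open>C(X) \<otimes> L(H)\<close>\<close>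

text \<open>
  Functions on a space are \<^const>\<open>extensional\<close> outside its underlying set, so that
  HOL equality of elements of the algebras below is equality of functions on the space.
\<close>

definition C_alg :: "'a topology \<Rightarrow> ('a \<Rightarrow> complex) star_algebra" where
  "C_alg X =
    \<lparr>carrier = {a \<in> extensional (topspace X). continuous_map X euclidean a},
     mult = (\<lambda>a b. \<lambda>x\<in>topspace X. a x * b x),
     one = (\<lambda>x\<in>topspace X. 1),
     zero = (\<lambda>x\<in>topspace X. 0),
     add = (\<lambda>a b. \<lambda>x\<in>topspace X. a x + b x),
     smult = (\<lambda>c a. \<lambda>x\<in>topspace X. c * a x),
     adj = (\<lambda>a. \<lambda>x\<in>topspace X. cnj (a x))\<rparr>"

text \<open>
  Up to unitary equivalence the nonzero finite-dimensional Hilbert spaces are the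
  \<open>H = \<complex>\<^sup>n\<close> with \<open>n > 0\<close> and the standard inner product; \<open>L(H)\<close> is then the algebra of
  complex \<open>n \<times> n\<close> matrices, with the conjugate transpose as involution.
\<close>

definition L_alg :: "nat \<Rightarrow> complex mat star_algebra" where
  "L_alg n =
    \<lparr>carrier = carrier_mat n n,
     mult = (*),
     one = 1\<^sub>m n,
     zero = 0\<^sub>m n n,
     add = (+),
     smult = (\<cdot>\<^sub>m),
     adj = mat_adjoint\<rparr>"

definition elem_tensor ::
  "'a topology \<Rightarrow> ('b, 'm) star_algebra_scheme \<Rightarrow> ('a \<Rightarrow> complex) \<Rightarrow> 'b \<Rightarrow> ('a \<Rightarrow> 'b)"
where
  "elem_tensor X B a b = (\<lambda>x\<in>topspace X. a x \<odot>\<^bsub>B\<^esub> b)"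

text \<open>
  \<open>C(X) \<otimes> B\<close> for a finite-dimensional C*-algebra \<open>B\<close>, realised by \<open>B\<close>-valued functions on
  \<open>X\<close> as the linear span of the elementary tensors \<open>a \<otimes> b\<close>. The algebraic tensor product with
  a finite-dimensional algebra is already complete, so no closure has to be taken. For
  \<open>B = L(H)\<close> one gets all continuous functions from \<open>X\<close> to \<open>L(H)\<close>: see the lemma
  \<open>C_tensor_L_carrier\<close>.
\<close>

inductive_set tensor_span ::
  "'a topology \<Rightarrow> ('b, 'm) star_algebra_scheme \<Rightarrow> ('a \<Rightarrow> 'b) set"
  for X :: "'a topology" and B :: "('b, 'm) star_algebra_scheme"
where
  elem: "a \<in> carrier (C_alg X) \<Longrightarrow> b \<in> carrier B \<Longrightarrow> elem_tensor X B a b \<in> tensor_span X B"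
| add: "F \<in> tensor_span X B \<Longrightarrow> G \<in> tensor_span X B \<Longrightarrow>
    (\<lambda>x\<in>topspace X. F x \<oplus>\<^bsub>B\<^esub> G x) \<in> tensor_span X B"

definition C_tensor ::
  "'a topology \<Rightarrow> ('b, 'm) star_algebra_scheme \<Rightarrow> ('a \<Rightarrow> 'b) star_algebra"
where
  "C_tensor X B =
    \<lparr>carrier = tensor_span X B,
     mult = (\<lambda>F G. \<lambda>x\<in>topspace X. F x \<otimes>\<^bsub>B\<^esub> G x),
     one = (\<lambda>x\<in>topspace X. \<one>\<^bsub>B\<^esub>),
     zero = (\<lambda>x\<in>topspace X. \<zero>\<^bsub>B\<^esub>),
     add = (\<lambda>F G. \<lambda>x\<in>topspace X. F x \<oplus>\<^bsub>B\<^esub> G x),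
     smult = (\<lambda>c F. \<lambda>x\<in>topspace X. c \<odot>\<^bsub>B\<^esub> F x),
     adj = (\<lambda>F. \<lambda>x\<in>topspace X. adj B (F x))\<rparr>"


section \<open>The maps \<open>g\<^sup>\<star>\<close> and \<open>g\<^sup>\<star> \<otimes> id\<close>\<close>

definition pullback :: "'a topology \<Rightarrow> ('a \<Rightarrow> 'b) \<Rightarrow> ('b \<Rightarrow> 'c) \<Rightarrow> ('a \<Rightarrow> 'c)" where
  "pullback X g a = (\<lambda>x\<in>topspace X. a (g x))"

text \<open>
  \<open>\<alpha> \<otimes> id : C(Y) \<otimes> B \<rightarrow> C(X) \<otimes> B\<close> for a linear map \<open>\<alpha> : C(Y) \<rightarrow> C(X)\<close>; additivity and the
  values on elementary tensors determine it, and imply its linearity. Existence and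
  uniqueness for \<open>\<alpha> = g\<^sup>\<star>\<close> and \<open>B = L(H)\<close> are \<open>is_tensor_id_pullback\<close> and
  \<open>is_tensor_id_unique\<close>.
\<close>

definition is_tensor_id ::
  "'b topology \<Rightarrow> 'a topology \<Rightarrow> ('c, 'm) star_algebra_scheme \<Rightarrow>
   (('b \<Rightarrow> complex) \<Rightarrow> ('a \<Rightarrow> complex)) \<Rightarrow> (('b \<Rightarrow> 'c) \<Rightarrow> ('a \<Rightarrow> 'c)) \<Rightarrow> bool"
where
  "is_tensor_id Y X B \<alpha> \<Psi> \<longleftrightarrow>
     \<Psi> \<in> extensional (carrier (C_tensor Y B)) \<and>
     (\<forall>F\<in>carrier (C_tensor Y B). \<forall>G\<in>carrier (C_tensor Y B).
        \<Psi> (F \<oplus>\<^bsub>C_tensor Y B\<^esub> G) = \<Psi> F \<oplus>\<^bsub>C_tensor X B\<^esub> \<Psi> G) \<and>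
     (\<forall>a\<in>carrier (C_alg Y). \<forall>b\<in>carrier B.
        \<Psi> (elem_tensor Y B a b) = elem_tensor X B (\<alpha> a) b)"

definition tensor_id ::
  "'b topology \<Rightarrow> 'a topology \<Rightarrow> ('c, 'm) star_algebra_scheme \<Rightarrow>
   (('b \<Rightarrow> complex) \<Rightarrow> ('a \<Rightarrow> complex)) \<Rightarrow> ('b \<Rightarrow> 'c) \<Rightarrow> ('a \<Rightarrow> 'c)"
where
  "tensor_id Y X B \<alpha> = (THE \<Psi>. is_tensor_id Y X B \<alpha> \<Psi>)"

lemma is_tensor_id_unique:
  assumes "is_tensor_id Y X B \<alpha> \<Psi>" and "is_tensor_id Y X B \<alpha> \<Psi>'"
  shows "\<Psi> = \<Psi>'"
proof (rule extensionalityI)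
  show "\<Psi> \<in> extensional (carrier (C_tensor Y B))" "\<Psi>' \<in> extensional (carrier (C_tensor Y B))"
    using assms by (auto simp: is_tensor_id_def)
  fix F assume "F \<in> carrier (C_tensor Y B)"
  then have "F \<in> tensor_span Y B" by (simp add: C_tensor_def)
  then show "\<Psi> F = \<Psi>' F"
  proof induction
    case (elem a b)
    then show ?case using assms by (simp add: is_tensor_id_def)
  next
    case (add F G)
    have "\<Psi> (F \<oplus>\<^bsub>C_tensor Y B\<^esub> G) = \<Psi>' (F \<oplus>\<^bsub>C_tensor Y B\<^esub> G)"
      using assms add unfolding is_tensor_id_def by (simp add: C_tensor_def del: restrict_apply)
    then show ?case unfolding C_tensor_def by (simp del: restrict_apply)
  qed
qed

lemma C_alg_carrier_iff:
  "a \<in> carrier (C_alg X) \<longleftrightarrow> a \<in> extensional (topspace X) \<and> continuous_map X euclidean a"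
  by (simp add: C_alg_def)

lemma tensor_span_L_dims:
  assumes "F \<in> tensor_span X (L_alg n)"
  shows "F \<in> extensional (topspace X)"
    and "x \<in> topspace X \<Longrightarrow> F x \<in> carrier_mat n n"
    and "i < n \<Longrightarrow> j < n \<Longrightarrow> continuous_map X euclidean (\<lambda>x. F x $$ (i, j))"
proof -
  have "F \<in> extensional (topspace X) \<and> (\<forall>x\<in>topspace X. F x \<in> carrier_mat n n) \<and>
      (\<forall>i<n. \<forall>j<n. continuous_map X euclidean (\<lambda>x. F x $$ (i, j)))"
    using assms
  proof induction
    case (elem a b)
    have b: "b \<in> carrier_mat n n" using elem by (simp add: L_alg_def)
    have "continuous_map X euclidean (\<lambda>x. elem_tensor X (L_alg n) a b x $$ (i, j))"
      if "i < n" "j < n" for i j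
    proof (rule continuous_map_eq)
      show "continuous_map X euclidean (\<lambda>x. a x * b $$ (i, j))"
        using elem
        by (intro continuous_map_compose[of X euclidean a euclidean "\<lambda>z. z * b $$ (i, j)",
              unfolded comp_def])
          (auto simp: C_alg_carrier_iff intro!: continuous_intros)
      show "a x * b $$ (i, j) = elem_tensor X (L_alg n) a b x $$ (i, j)" if "x \<in> topspace X" for x
        using that \<open>i < n\<close> \<open>j < n\<close> b by (simp add: elem_tensor_def L_alg_def)
    qed
    moreover have "elem_tensor X (L_alg n) a b \<in> extensional (topspace X)"
      by (simp add: elem_tensor_def extensional_def)
    moreover have "\<forall>x\<in>topspace X. elem_tensor X (L_alg n) a b x \<in> carrier_mat n n"
      using b by (simp add: elem_tensor_def L_alg_def)
    ultimately show ?case by blast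
  next
    case (add F G)
    have "continuous_map X euclidean
        (\<lambda>x. (\<lambda>x\<in>topspace X. F x \<oplus>\<^bsub>L_alg n\<^esub> G x) x $$ (i, j))"
      if ij: "i < n" "j < n" for i j
    proof (rule continuous_map_eq)
      show "continuous_map X euclidean (\<lambda>x. F x $$ (i, j) + G x $$ (i, j))"
        using add ij by (intro continuous_map_add) auto
      show "F x $$ (i, j) + G x $$ (i, j) = (\<lambda>x\<in>topspace X. F x \<oplus>\<^bsub>L_alg n\<^esub> G x) x $$ (i, j)"
        if x: "x \<in> topspace X" for x
      proof -
        have "F x \<in> carrier_mat n n" "G x \<in> carrier_mat n n" using add x by auto
        then show ?thesis using x ij by (simp add: L_alg_def)
      qed
    qed
    moreover have "\<forall>x\<in>topspace X. (\<lambda>x\<in>topspace X. F x \<oplus>\<^bsub>L_alg n\<^esub> G x) x \<in> carrier_mat n n"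
      using add by (auto simp: L_alg_def)
    moreover have "(\<lambda>x\<in>topspace X. F x \<oplus>\<^bsub>L_alg n\<^esub> G x) \<in> extensional (topspace X)"
      by (rule restrict_extensional)
    ultimately show ?case by blast
  qed
  then show "F \<in> extensional (topspace X)"
    and "x \<in> topspace X \<Longrightarrow> F x \<in> carrier_mat n n"
    and "i < n \<Longrightarrow> j < n \<Longrightarrow> continuous_map X euclidean (\<lambda>x. F x $$ (i, j))"
    by auto
qed

lemma tensor_span_L_cutoff:
  assumes F: "F \<in> extensional (topspace X)" "\<And>x. x \<in> topspace X \<Longrightarrow> F x \<in> carrier_mat n n"
    "\<And>i j. i < n \<Longrightarrow> j < n \<Longrightarrow> continuous_map X euclidean (\<lambda>x. F x $$ (i, j))"
    and S: "finite S" "S \<subseteq> {..<n} \<times> {..<n}"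
  shows "(\<lambda>x\<in>topspace X. mat n n (\<lambda>p. if p \<in> S then F x $$ p else 0)) \<in> tensor_span X (L_alg n)"
  using S
proof (induction S rule: finite_induct)
  case empty
  have "elem_tensor X (L_alg n) (\<lambda>x\<in>topspace X. 0) (0\<^sub>m n n) \<in> tensor_span X (L_alg n)"
    by (rule tensor_span.elem)
      (auto simp: C_alg_carrier_iff L_alg_def intro: continuous_map_eq[of _ _ "\<lambda>x. 0"])
  moreover have "elem_tensor X (L_alg n) (\<lambda>x\<in>topspace X. 0) (0\<^sub>m n n) =
      (\<lambda>x\<in>topspace X. mat n n (\<lambda>p. if p \<in> {} then F x $$ p else 0))"
    by (rule ext) (auto simp: elem_tensor_def L_alg_def)
  ultimately show ?case by metis
next
  case (insert q S)
  define a where "a = (\<lambda>x\<in>topspace X. F x $$ q)"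
  define E where "E = mat n n (\<lambda>p. if p = q then 1 else 0 :: complex)"
  have "elem_tensor X (L_alg n) a E \<in> tensor_span X (L_alg n)"
  proof (rule tensor_span.elem)
    obtain i j where q: "q = (i, j)" "i < n" "j < n" using insert.prems by (cases q) auto
    show "a \<in> carrier (C_alg X)"
      using F(3)[OF q(2,3)] q(1)
      by (auto simp: C_alg_carrier_iff a_def intro: continuous_map_eq)
    show "E \<in> carrier (L_alg n)" by (simp add: E_def L_alg_def)
  qed
  from tensor_span.add[OF this insert.IH]
  have "(\<lambda>x\<in>topspace X. elem_tensor X (L_alg n) a E x \<oplus>\<^bsub>L_alg n\<^esub>
      (\<lambda>x\<in>topspace X. mat n n (\<lambda>p. if p \<in> S then F x $$ p else 0)) x) \<in> tensor_span X (L_alg n)"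
    using insert.prems by simp
  also have "(\<lambda>x\<in>topspace X. elem_tensor X (L_alg n) a E x \<oplus>\<^bsub>L_alg n\<^esub>
      (\<lambda>x\<in>topspace X. mat n n (\<lambda>p. if p \<in> S then F x $$ p else 0)) x) =
      (\<lambda>x\<in>topspace X. mat n n (\<lambda>p. if p \<in> insert q S then F x $$ p else 0))"
    using insert.hyps
    by (intro ext) (auto simp: elem_tensor_def L_alg_def a_def E_def intro!: eq_matI)
  finally show ?case .
qed

lemma C_tensor_L_carrier:
  "carrier (C_tensor X (L_alg n)) =
    {F \<in> extensional (topspace X). (\<forall>x\<in>topspace X. F x \<in> carrier_mat n n) \<and>
      (\<forall>i<n. \<forall>j<n. continuous_map X euclidean (\<lambda>x. F x $$ (i, j)))}" (is "_ = ?R")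
proof (intro equalityI subsetI)
  fix F assume "F \<in> carrier (C_tensor X (L_alg n))"
  then show "F \<in> ?R" using tensor_span_L_dims[of F X n] by (auto simp: C_tensor_def)
next
  fix F assume "F \<in> ?R"
  then have F: "F \<in> extensional (topspace X)" "\<And>x. x \<in> topspace X \<Longrightarrow> F x \<in> carrier_mat n n"
    "\<And>i j. i < n \<Longrightarrow> j < n \<Longrightarrow> continuous_map X euclidean (\<lambda>x. F x $$ (i, j))" by auto
  have "(\<lambda>x\<in>topspace X. mat n n (\<lambda>p. if p \<in> {..<n} \<times> {..<n} then F x $$ p else 0)) = F"
  proof (rule extensionalityI[OF restrict_extensional F(1)])
    fix x assume x: "x \<in> topspace X"
    show "(\<lambda>x\<in>topspace X. mat n n (\<lambda>p. if p \<in> {..<n} \<times> {..<n} then F x $$ p else 0)) x = F x"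
      using F(2)[OF x] x by (auto intro!: eq_matI)
  qed
  with tensor_span_L_cutoff[OF F, of "{..<n} \<times> {..<n}"]
  show "F \<in> carrier (C_tensor X (L_alg n))" by (simp add: C_tensor_def)
qed

lemma is_tensor_id_pullback:
  assumes g: "continuous_map X Y g"
  shows "is_tensor_id Y X (L_alg n) (pullback X g)
    (restrict (pullback X g) (carrier (C_tensor Y (L_alg n))))"
proof -
  have gx: "g x \<in> topspace Y" if "x \<in> topspace X" for x
    using g that by (auto simp: continuous_map_def)
  have add: "F \<oplus>\<^bsub>C_tensor Y (L_alg n)\<^esub> G \<in> carrier (C_tensor Y (L_alg n))"
    if "F \<in> carrier (C_tensor Y (L_alg n))" "G \<in> carrier (C_tensor Y (L_alg n))" for F G
    using that tensor_span.add[of F Y "L_alg n" G] by (simp add: C_tensor_def)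
  have elem: "elem_tensor Y (L_alg n) a b \<in> carrier (C_tensor Y (L_alg n))"
    if "a \<in> carrier (C_alg Y)" "b \<in> carrier (L_alg n)" for a b
    using that tensor_span.elem[of a Y b "L_alg n"] by (simp add: C_tensor_def)
  show ?thesis
    unfolding is_tensor_id_def
  proof (intro conjI ballI)
    fix F G
    assume FG: "F \<in> carrier (C_tensor Y (L_alg n))" "G \<in> carrier (C_tensor Y (L_alg n))"
    have "pullback X g (F \<oplus>\<^bsub>C_tensor Y (L_alg n)\<^esub> G) =
        pullback X g F \<oplus>\<^bsub>C_tensor X (L_alg n)\<^esub> pullback X g G"
      by (rule ext) (simp add: C_tensor_def pullback_def gx restrict_def)
    with FG add[OF FG]
    show "restrict (pullback X g) (carrier (C_tensor Y (L_alg n))) (F \<oplus>\<^bsub>C_tensor Y (L_alg n)\<^esub> G) =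
        restrict (pullback X g) (carrier (C_tensor Y (L_alg n))) F
        \<oplus>\<^bsub>C_tensor X (L_alg n)\<^esub>
        restrict (pullback X g) (carrier (C_tensor Y (L_alg n))) G"
      by simp
  next
    fix a b assume ab: "a \<in> carrier (C_alg Y)" "b \<in> carrier (L_alg n)"
    have "pullback X g (elem_tensor Y (L_alg n) a b) = elem_tensor X (L_alg n) (pullback X g a) b"
      by (rule ext) (simp add: elem_tensor_def pullback_def gx restrict_def)
    with elem[OF ab]
    show "restrict (pullback X g) (carrier (C_tensor Y (L_alg n))) (elem_tensor Y (L_alg n) a b) =
        elem_tensor X (L_alg n) (pullback X g a) b"
      by simp
  qed simp
qed

lemma tensor_id_pullback:
  assumes "continuous_map X Y g" and "F \<in> carrier (C_tensor Y (L_alg n))"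
  shows "tensor_id Y X (L_alg n) (pullback X g) F = pullback X g F"
proof -
  let ?P = "is_tensor_id Y X (L_alg n) (pullback X g)"
  have "\<exists>!\<Psi>. ?P \<Psi>"
    using is_tensor_id_pullback[OF assms(1)] by (blast intro: is_tensor_id_unique)
  then have "?P (tensor_id Y X (L_alg n) (pullback X g))"
    unfolding tensor_id_def by (rule theI')
  then have "tensor_id Y X (L_alg n) (pullback X g) =
      restrict (pullback X g) (carrier (C_tensor Y (L_alg n)))"
    by (rule is_tensor_id_unique[OF _ is_tensor_id_pullback[OF assms(1)]])
  then show ?thesis using assms(2) by simp
qed


section \<open>Loops and quantum nullhomotopy\<close>

definition S1 :: "complex topology" where
  "S1 = top_of_set (sphere 0 1)"

definition D2 :: "complex topology" where
  "D2 = top_of_set (cball 0 1)"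

definition loop_in :: "'a topology \<Rightarrow> (complex \<Rightarrow> 'a) \<Rightarrow> bool" where
  "loop_in T f \<longleftrightarrow> continuous_map S1 T f"

text \<open>The inclusion \<open>j : S\<^sup>1 \<rightarrow> D\<^sup>2\<close> is \<^const>\<open>id\<close>.\<close>

definition quantum_nullhomotopic :: "'a topology \<Rightarrow> (complex \<Rightarrow> 'a) \<Rightarrow> bool" where
  "quantum_nullhomotopic T f \<longleftrightarrow>
     (\<exists>n>0. \<exists>\<phi>. unital_star_hom (C_alg T) (C_tensor D2 (L_alg n)) \<phi> \<and>
        (\<forall>a\<in>carrier (C_alg T).
           tensor_id D2 S1 (L_alg n) (pullback S1 id) (\<phi> a) =
           elem_tensor S1 (L_alg n) (pullback S1 f a) \<one>\<^bsub>L_alg n\<^esub>))"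


section \<open>The real projective plane\<close>

definition S2 :: "(real ^ 3) topology" where
  "S2 = top_of_set (sphere 0 1)"

definition antipodal_class :: "real ^ 3 \<Rightarrow> (real ^ 3) set" where
  "antipodal_class x = {x, - x}"

definition RP2 :: "(real ^ 3) set topology" where
  "RP2 = topology (\<lambda>U. U \<subseteq> antipodal_class ` topspace S2 \<and>
     openin S2 {x \<in> topspace S2. antipodal_class x \<in> U})"

lemma openin_RP2:
  "openin RP2 U \<longleftrightarrow> U \<subseteq> antipodal_class ` topspace S2 \<and>
     openin S2 {x \<in> topspace S2. antipodal_class x \<in> U}"
proof -
  have "istopology (\<lambda>U. U \<subseteq> antipodal_class ` topspace S2 \<and>
     openin S2 {x \<in> topspace S2. antipodal_class x \<in> U})"
    unfolding istopology_def
  proof (intro conjI allI impI)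
    fix U V assume "U \<subseteq> antipodal_class ` topspace S2 \<and>
        openin S2 {x \<in> topspace S2. antipodal_class x \<in> U}"
      and "V \<subseteq> antipodal_class ` topspace S2 \<and>
        openin S2 {x \<in> topspace S2. antipodal_class x \<in> V}"
    moreover have "{x \<in> topspace S2. antipodal_class x \<in> U \<inter> V} =
        {x \<in> topspace S2. antipodal_class x \<in> U} \<inter> {x \<in> topspace S2. antipodal_class x \<in> V}"
      by auto
    ultimately show "U \<inter> V \<subseteq> antipodal_class ` topspace S2"
      "openin S2 {x \<in> topspace S2. antipodal_class x \<in> U \<inter> V}" by auto
  next
    fix K assume K: "\<forall>U\<in>K. U \<subseteq> antipodal_class ` topspace S2 \<and>
        openin S2 {x \<in> topspace S2. antipodal_class x \<in> U}"
    then show "\<Union>K \<subseteq> antipodal_class ` topspace S2" by auto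
    have "{x \<in> topspace S2. antipodal_class x \<in> \<Union>K} =
        \<Union>((\<lambda>U. {x \<in> topspace S2. antipodal_class x \<in> U}) ` K)" by auto
    then show "openin S2 {x \<in> topspace S2. antipodal_class x \<in> \<Union>K}"
      using K by auto
  qed
  then show ?thesis unfolding RP2_def by (simp add: topology_inverse')
qed

lemma topspace_RP2: "topspace RP2 = antipodal_class ` topspace S2"
proof
  show "topspace RP2 \<subseteq> antipodal_class ` topspace S2"
    using openin_topspace[of RP2] unfolding openin_RP2 by simp
  have "{x \<in> topspace S2. antipodal_class x \<in> antipodal_class ` topspace S2} = topspace S2" by auto
  then have "openin RP2 (antipodal_class ` topspace S2)"
    by (simp add: openin_RP2)
  then show "antipodal_class ` topspace S2 \<subseteq> topspace RP2"
    by (rule openin_subset)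
qed

lemma quotient_map_RP2: "quotient_map S2 RP2 antipodal_class"
  unfolding quotient_map_def by (auto simp: topspace_RP2 openin_RP2)

lemma compact_space_RP2: "compact_space RP2"
proof -
  have "compact_space S2" by (simp add: S2_def compact_space_subtopology)
  then have "compactin RP2 (antipodal_class ` topspace S2)"
    using quotient_imp_continuous_map[OF quotient_map_RP2]
    by (intro image_compactin) (auto simp: compact_space_def)
  then show ?thesis by (simp add: compact_space_def topspace_RP2)
qed

lemma Hausdorff_space_RP2: "Hausdorff_space RP2"
proof -
  have cont: "continuous_map S2 RP2 antipodal_class"
    by (rule quotient_imp_continuous_map[OF quotient_map_RP2])
  have "homeomorphic_map S2 S2 uminus"
    unfolding S2_def homeomorphic_map_maps homeomorphic_maps_def
    by (intro exI[of _ uminus]) (auto intro!: continuous_intros)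
  then have neg: "closedin S2 (uminus ` C)" if "closedin S2 C" for C
    using that homeomorphic_imp_closed_map closed_map_def by blast
  have closed: "closed_map S2 RP2 antipodal_class"
    unfolding closed_map_def
  proof (intro allI impI)
    fix C assume C: "closedin S2 C"
    then have sub: "C \<subseteq> topspace S2" by (rule closedin_subset)
    have "{x \<in> topspace S2. antipodal_class x \<in> antipodal_class ` C} = C \<union> uminus ` C"
      using sub by (auto simp: antipodal_class_def S2_def doubleton_eq_iff image_iff)
    also have "closedin S2 (C \<union> uminus ` C)" using C neg by blast
    finally have pre: "closedin S2 {x \<in> topspace S2. antipodal_class x \<in> antipodal_class ` C}" .
    have "antipodal_class ` C \<subseteq> topspace RP2" using sub by (auto simp: topspace_RP2)
    with quotient_map_RP2[unfolded quotient_map_closedin, THEN conjunct2, rule_format]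
    have "closedin S2 {x \<in> topspace S2. antipodal_class x \<in> antipodal_class ` C} \<longleftrightarrow>
        closedin RP2 (antipodal_class ` C)" by this
    with pre show "closedin RP2 (antipodal_class ` C)" by (rule iffD1[rotated])
  qed
  have "compactin S2 {x \<in> topspace S2. antipodal_class x = y}"
    if "y \<in> topspace RP2" for y
  proof -
    from that obtain z where z: "z \<in> topspace S2" "y = antipodal_class z"
      by (auto simp: topspace_RP2)
    have "{x \<in> topspace S2. antipodal_class x = y} \<subseteq> {z, - z}"
      using z by (auto simp: antipodal_class_def doubleton_eq_iff)
    then have "finite {x \<in> topspace S2. antipodal_class x = y}"
      by (rule finite_subset) simp
    then show ?thesis by (intro finite_imp_compactin) auto
  qed
  then have "perfect_map S2 RP2 antipodal_class"
    using closed cont by (auto simp: perfect_map_def proper_map_def topspace_RP2)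
  moreover have "Hausdorff_space S2"
    by (simp add: S2_def Hausdorff_space_subtopology)
  moreover have "compact_space S2"
    by (simp add: S2_def compact_space_subtopology)
  ultimately have "regular_space RP2"
    using compact_Hausdorff_imp_regular_space regular_space_perfect_map_image by blast
  moreover have "t1_space RP2"
    unfolding t1_space_closedin_singleton
  proof
    fix y assume "y \<in> topspace RP2"
    then obtain z where z: "z \<in> topspace S2" "y = antipodal_class z"
      by (auto simp: topspace_RP2)
    have "closedin S2 {z}"
      using z \<open>Hausdorff_space S2\<close> by (simp add: closedin_Hausdorff_sing_eq)
    then have "closedin RP2 (antipodal_class ` {z})"
      using closed unfolding closed_map_def by blast
    then show "closedin RP2 {y}" using z by simp
  qed
  ultimately show ?thesis using regular_t1_imp_Hausdorff_space by blast
qed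

end

theory Submission
  imports Defs
begin

text \<open>
  Two-dimensional Hilbert spaces suffice. Call \<open>*\<close> the base point of the loop \<open>f\<close>. The diagonal
  representation \<open>a \<mapsto> a(f) 1\<close> splits as \<open>f\<close> on each of two orthogonal lines, and it is homotopic to
  the loop that first runs through \<open>f\<close> on the first line and then through \<open>f\<close> on the second, resting
  at \<open>*\<close> on the other line. When both lines carry the label \<open>*\<close> the decomposition is invisible, so
  in the second half the two lines may be rotated into each other. Now \<open>f \<cdot> f\<close> runs on the first
  line and \<open>*\<close> rests on the second; since \<open>f \<cdot> f\<close> lifts to a closed loop in the sphere, which is
  simply connected, it can be contracted.
\<close>

section \<open>Homotopies of representations\<close>

text \<open>
  The representations are recorded as families of matrix entries in a function type, where the
  product topology is the topology of pointwise convergence on \<open>C(T)\<close>.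
\<close>

definition star_reps :: "'a topology \<Rightarrow> nat \<Rightarrow> (('a \<Rightarrow> complex) \<Rightarrow> nat \<Rightarrow> nat \<Rightarrow> complex) set" where
  "star_reps T n =
    {\<Phi>. unital_star_hom (C_alg T) (L_alg n) (\<lambda>a. mat n n (\<lambda>(i, j). \<Phi> a i j))}"

text \<open>The default 0 reduces continuity in the product topology to continuity of the values
  \<open>a t\<close>, and lets \<open>pair_rep_same\<close> hold as an equality of
  functions.\<close>

definition scalar_rep ::
  "'a topology \<Rightarrow> nat \<Rightarrow> 'a \<Rightarrow> ('a \<Rightarrow> complex) \<Rightarrow> nat \<Rightarrow> nat \<Rightarrow> complex"
where
  "scalar_rep T n t a i j = (if a \<in> carrier (C_alg T) \<and> i < n \<and> i = j then a t else 0)"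

text \<open>The operations of \<open>C_tensor\<close> are pointwise, so the homomorphism laws are
  inherited from each \<open>G x\<close>; continuity of the entries is what places the values in the
  carrier.\<close>

lemma unital_star_hom_C_tensorI:
  assumes G: "\<And>a i j. a \<in> carrier (C_alg T) \<Longrightarrow> i < n \<Longrightarrow> j < n \<Longrightarrow>
      continuous_map X euclidean (\<lambda>x. G x a i j)"
    and K: "\<And>x. x \<in> topspace X \<Longrightarrow> G x \<in> star_reps T n"
  shows "unital_star_hom (C_alg T) (C_tensor X (L_alg n))
    (\<lambda>a. \<lambda>x\<in>topspace X. mat n n (\<lambda>(i, j). G x a i j))"
proof -
  define \<phi> where "\<phi> x a = mat n n (\<lambda>(i, j). G x a i j)" for x a
  have hom: "unital_star_hom (C_alg T) (L_alg n) (\<phi> x)" if "x \<in> topspace X" for x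
    using K[OF that] by (simp add: star_reps_def \<phi>_def[abs_def])
  have ring: "\<phi> x \<in> Ring.ring_hom (C_alg T) (L_alg n)" if "x \<in> topspace X" for x
    using hom[OF that] by (simp add: unital_star_hom_def)
  have "(\<lambda>a. \<lambda>x\<in>topspace X. \<phi> x a) \<in> Ring.ring_hom (C_alg T) (C_tensor X (L_alg n))"
  proof (rule ring_hom_memI)
    fix a assume a: "a \<in> carrier (C_alg T)"
    have "continuous_map X euclidean (\<lambda>x. (\<lambda>x\<in>topspace X. \<phi> x a) x $$ (i, j))"
      if "i < n" "j < n" for i j
      by (rule continuous_map_eq[OF G[OF a that]]) (use that in \<open>simp add: \<phi>_def\<close>)
    then show "(\<lambda>x\<in>topspace X. \<phi> x a) \<in> carrier (C_tensor X (L_alg n))"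
      by (auto simp: C_tensor_L_carrier \<phi>_def simp del: restrict_apply simp: restrict_apply')
  qed (auto simp: C_tensor_def restrict_def
        ring_hom_mult[OF ring] ring_hom_add[OF ring] ring_hom_one[OF ring])
  then show ?thesis
    unfolding unital_star_hom_def \<phi>_def[symmetric]
    using hom by (auto simp: C_tensor_def restrict_def unital_star_hom_def)
qed

text \<open>These are polar coordinates with the radius reversed: the edge \<open>s = 0\<close>
  covers the circle and \<open>s = 1\<close> collapses to the centre. A continuous surjection from a
  compact space onto a Hausdorff space is closed, hence a quotient map.\<close>

lemma quotient_map_square_disc:
  "quotient_map (top_of_set ({0..1} \<times> {0..1})) (top_of_set (cball 0 1))
    (\<lambda>(s, t). complex_of_real (1 - s) * cis (2 * pi * t))"
proof -
  let ?q = "\<lambda>(s, t). complex_of_real (1 - s) * cis (2 * pi * t)"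
  have "continuous_on ({0..1} \<times> {0..1}) ?q"
    unfolding cis_conv_exp case_prod_beta by (intro continuous_intros)
  moreover have image: "?q ` ({0..1} \<times> {0..1}) = cball 0 1"
  proof (intro equalityI subsetI)
    fix z :: complex assume z: "z \<in> cball 0 1"
    have "z = complex_of_real (1 - (1 - norm z)) * cis (2 * pi * (Arg2pi z / (2 * pi)))"
      using Arg2pi_eq[of z] by (simp add: cis_conv_exp)
    moreover have "1 - norm z \<in> {0..1}" "Arg2pi z / (2 * pi) \<in> {0..1}"
      using z Arg2pi[of z] by auto
    ultimately show "z \<in> ?q ` ({0..1} \<times> {0..1})"
      by (intro image_eqI[of _ _ "(1 - norm z, Arg2pi z / (2 * pi))"]) auto
  qed (auto simp: norm_mult simp del: of_real_diff)
  ultimately have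
    cont: "continuous_map (top_of_set ({0..1} \<times> {0..1})) (top_of_set (cball 0 1)) ?q"
    by auto
  moreover have "closed_map (top_of_set ({0..1} \<times> {0..1})) (top_of_set (cball 0 1)) ?q"
  proof (rule continuous_imp_closed_map_gen[OF _ _ cont])
    show "compact_space (top_of_set ({0..1::real} \<times> {0..1::real}))"
      by (simp add: compact_space_subtopology compact_Times)
    show "kc_space (top_of_set (cball (0::complex) 1))"
      by (intro Hausdorff_imp_kc_space Hausdorff_space_subtopology) simp
  qed
  ultimately show ?thesis
    using image by (intro continuous_closed_imp_quotient_map) auto
qed

text \<open>The homotopy is constant on one edge of the square and equal on two opposite ones. These
  are the identifications made by polar coordinates, so it descends to the disc.\<close>

lemma homotopic_loops_const_extends_to_disc:
  assumes "homotopic_loops K p (\<lambda>_. c)"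
  obtains G where "continuous_on (cball (0::complex) 1) G" "G \<in> cball 0 1 \<rightarrow> K"
    "\<And>t. t \<in> {0..1} \<Longrightarrow> G (cis (2 * pi * t)) = p t"
proof -
  let ?q = "\<lambda>(s, t). complex_of_real (1 - s) * cis (2 * pi * t)"
  obtain h :: "real \<times> real \<Rightarrow> _" where h: "continuous_on ({0..1} \<times> {0..1}) h"
    "h \<in> {0..1} \<times> {0..1} \<rightarrow> K"
    "\<forall>t\<in>{0..1}. h (0, t) = p t" "\<forall>t\<in>{0..1}. h (1, t) = c"
    "\<forall>s\<in>{0..1}. h (s, 1) = h (s, 0)"
    using assms unfolding homotopic_loops pathfinish_def pathstart_def comp_def by blast
  \<comment> \<open>\<open>Arg2pi\<close> jumps along the positive real axis, so continuity of
    \<open>G\<close> is not visible here; it comes from the quotient map.\<close>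
  define G where "G z = h (1 - norm z, Arg2pi z / (2 * pi))" for z
  have Gq: "G (?q (s, t)) = h (s, t)" if "s \<in> {0..1}" "t \<in> {0..1}" for s t
  \<comment> \<open>At the centre and at \<open>t = 1\<close> the angle read off is 0, which may
    differ from \<open>2 * pi * t\<close>; the boundary conditions on \<open>h\<close> repair
    this.\<close>
  proof (cases "s = 1 \<or> t = 1")
    case True
    moreover have "Arg2pi (complex_of_real (1 - s)) = 0"
      using that by (subst Arg2pi_eq_0) auto
    moreover have "Arg2pi 0 = 0" by (simp add: Arg2pi_def)
    moreover have "1 - norm (complex_of_real (1 - s)) = s"
      using that by (simp del: of_real_diff)
    ultimately show ?thesis
      using that h(4,5) by (auto simp: G_def simp del: of_real_diff)
  next
    case False
    have "Arg2pi (complex_of_real (1 - s) * cis (2 * pi * t)) = 2 * pi * t"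
      by (rule Arg2pi_unique[of "1 - s"]) (use that False in \<open>auto simp: cis_conv_exp\<close>)
    moreover have "1 - norm (complex_of_real (1 - s)) = s"
      using that by (simp del: of_real_diff)
    ultimately show ?thesis by (simp add: G_def norm_mult del: of_real_diff)
  qed
  show thesis
  proof
    have "continuous_map (top_of_set ({0..1} \<times> {0..1})) euclidean (G \<circ> ?q)"
    proof (rule continuous_map_eq)
      show "continuous_map (top_of_set ({0..1} \<times> {0..1})) euclidean h" using h(1) by simp
      fix z :: "real \<times> real" assume z: "z \<in> topspace (top_of_set ({0..1} \<times> {0..1}))"
      obtain s t where "z = (s, t)" by (cases z)
      with z show "h z = (G \<circ> ?q) z" using Gq[of s t] by simp
    qed
    then have "continuous_map (top_of_set (cball 0 1)) euclidean G"
      by (rule continuous_compose_quotient_map[OF quotient_map_square_disc])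
    then show "continuous_on (cball 0 1) G" by simp
    show "G \<in> cball 0 1 \<rightarrow> K"
    proof
      fix z :: complex assume "z \<in> cball 0 1"
      then have "(1 - norm z, Arg2pi z / (2 * pi)) \<in> {0..1} \<times> {0..1}"
        using Arg2pi[of z] by auto
      then show "G z \<in> K" using h(2) by (auto simp: G_def)
    qed
    show "G (cis (2 * pi * t)) = p t" if "t \<in> {0..1}" for t
      using Gq[of 0 t] h(3) that by simp
  qed
qed

text \<open>Over the circle the required representation is the scalar one at \<open>f z\<close>, so
  a contraction of that loop, spread over the disc, is the required homomorphism. Pointwise
  convergence is enough, since only the entries for one fixed \<open>a\<close> have to be
  continuous.\<close>

lemma quantum_nullhomotopicI:
  assumes f: "loop_in T f" and n: "n > 0"
    and hom: "homotopic_loops (star_reps T n) (\<lambda>t. scalar_rep T n (f (cis (2 * pi * t)))) (\<lambda>_. c)"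
  shows "quantum_nullhomotopic T f"
proof -
  obtain G where G: "continuous_on (cball 0 1) G" "G \<in> cball 0 1 \<rightarrow> star_reps T n"
    "\<And>t. t \<in> {0..1} \<Longrightarrow> G (cis (2 * pi * t)) = scalar_rep T n (f (cis (2 * pi * t)))"
    using homotopic_loops_const_extends_to_disc[OF hom] by blast
  define \<phi> where "\<phi> a = (\<lambda>z\<in>topspace D2. mat n n (\<lambda>(i, j). G z a i j))" for a
  have \<phi>: "unital_star_hom (C_alg T) (C_tensor D2 (L_alg n)) \<phi>"
    unfolding \<phi>_def[abs_def]
  proof (rule unital_star_hom_C_tensorI)
    show "continuous_map D2 euclidean (\<lambda>z. G z a i j)" for a i j
      using continuous_on_product_then_coordinatewise[OF
          continuous_on_product_then_coordinatewise[OF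
            continuous_on_product_then_coordinatewise[OF G(1), of a], of i], of j]
      by (simp add: D2_def)
    show "G z \<in> star_reps T n" if "z \<in> topspace D2" for z
      using that G(2) by (auto simp: D2_def)
  qed
  have "tensor_id D2 S1 (L_alg n) (pullback S1 id) (\<phi> a) =
      elem_tensor S1 (L_alg n) (pullback S1 f a) \<one>\<^bsub>L_alg n\<^esub>"
    if a: "a \<in> carrier (C_alg T)" for a
  proof -
    have "\<phi> a \<in> carrier (C_tensor D2 (L_alg n))"
      using \<phi> a by (auto simp: unital_star_hom_def dest: ring_hom_closed)
    moreover have "continuous_map S1 D2 id"
      by (auto simp: S1_def D2_def)
    ultimately have "tensor_id D2 S1 (L_alg n) (pullback S1 id) (\<phi> a) = pullback S1 id (\<phi> a)"
      by (intro tensor_id_pullback)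
    also have "\<dots> = elem_tensor S1 (L_alg n) (pullback S1 f a) \<one>\<^bsub>L_alg n\<^esub>"
    proof (rule extensionalityI[of _ "topspace S1"])
      fix z assume z: "z \<in> topspace S1"
      then have "cis (2 * pi * (Arg2pi z / (2 * pi))) = z"
        using Arg2pi_eq[of z] by (simp add: S1_def cis_conv_exp)
      moreover have "Arg2pi z / (2 * pi) \<in> {0..1}" using Arg2pi[of z] by auto
      ultimately have "G z = scalar_rep T n (f z)" using G(3) by metis
      moreover have "z \<in> topspace D2" using z by (auto simp: S1_def D2_def)
      ultimately show "pullback S1 id (\<phi> a) z =
          elem_tensor S1 (L_alg n) (pullback S1 f a) \<one>\<^bsub>L_alg n\<^esub> z"
        using z a by (auto simp: pullback_def \<phi>_def elem_tensor_def L_alg_def scalar_rep_def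
            intro!: eq_matI)
    qed (auto simp: pullback_def elem_tensor_def)
    finally show ?thesis .
  qed
  with \<phi> n show ?thesis unfolding quantum_nullhomotopic_def by blast
qed


section \<open>Representations supported at two points\<close>

text \<open>
  \<open>a \<mapsto> a(u) P + a(v) (1 - P)\<close>, where \<open>P\<close> is the projection onto the line through
  \<open>(cos \<theta>, sin \<theta>)\<close>.
\<close>

definition line_proj :: "real \<Rightarrow> nat \<Rightarrow> nat \<Rightarrow> complex" where
  "line_proj \<theta> i j =
    complex_of_real (if i = 0 then cos \<theta> else sin \<theta>) * (if j = 0 then cos \<theta> else sin \<theta>)"

definition pair_rep ::
  "'a topology \<Rightarrow> real \<Rightarrow> 'a \<Rightarrow> 'a \<Rightarrow> ('a \<Rightarrow> complex) \<Rightarrow> nat \<Rightarrow> nat \<Rightarrow> complex"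
where
  "pair_rep T \<theta> u v a i j =
    (if a \<in> carrier (C_alg T) \<and> i < 2 \<and> j < 2
     then a u * line_proj \<theta> i j + a v * ((if i = j then 1 else 0) - line_proj \<theta> i j) else 0)"

text \<open>The two complementary projections add up to 1. This keeps the endpoints fixed while the
  lines are rotated.\<close>

lemma pair_rep_same: "pair_rep T \<theta> u u = scalar_rep T 2 u"
  by (intro ext) (auto simp: pair_rep_def scalar_rep_def algebra_simps)

lemma pair_rep_quarter_turn: "pair_rep T (pi / 2) u v = pair_rep T 0 v u"
  by (intro ext) (auto simp: pair_rep_def line_proj_def less_2_cases_iff)

text \<open>The matrix is \<open>w w^T\<close> for the unit vector
  \<open>w = (cos \<theta>, sin \<theta>)\<close>; squaring it produces the factor
  \<open>w^T w = 1\<close>.\<close>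

lemma line_proj_idem:
  assumes "i < 2" "j < 2"
  shows "line_proj \<theta> i 0 * line_proj \<theta> 0 j + line_proj \<theta> i 1 * line_proj \<theta> 1 j = line_proj \<theta> i j"
proof -
  define w where "w k = complex_of_real (if k = 0 then cos \<theta> else sin \<theta>)" for k :: nat
  have "line_proj \<theta> i 0 * line_proj \<theta> 0 j + line_proj \<theta> i 1 * line_proj \<theta> 1 j =
      w i * w j * (w 0 * w 0 + w 1 * w 1)"
    by (simp add: line_proj_def w_def algebra_simps)
  also have "w 0 * w 0 + w 1 * w 1 = complex_of_real (cos \<theta> * cos \<theta> + sin \<theta> * sin \<theta>)"
    unfolding w_def of_real_add of_real_mult by simp
  also have "w i * w j * \<dots> = line_proj \<theta> i j"
    unfolding sin_cos_squared_add3 by (simp add: line_proj_def w_def)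
  finally show ?thesis .
qed

lemma C_alg_closed:
  assumes "a \<in> carrier (C_alg T)"
  shows "b \<in> carrier (C_alg T) \<Longrightarrow> a \<otimes>\<^bsub>C_alg T\<^esub> b \<in> carrier (C_alg T)"
    and "b \<in> carrier (C_alg T) \<Longrightarrow> a \<oplus>\<^bsub>C_alg T\<^esub> b \<in> carrier (C_alg T)"
    and "c \<odot>\<^bsub>C_alg T\<^esub> a \<in> carrier (C_alg T)"
    and "adj (C_alg T) a \<in> carrier (C_alg T)"
proof -
  have restrict: "(\<lambda>x\<in>topspace T. h x) \<in> carrier (C_alg T)" if "continuous_map T euclidean h" for h
    unfolding C_alg_carrier_iff using continuous_map_eq[OF that] by simp
  have a: "continuous_map T euclidean a" using assms by (simp add: C_alg_carrier_iff)
  {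
    assume "b \<in> carrier (C_alg T)"
    then have b: "continuous_map T euclidean b" by (simp add: C_alg_carrier_iff)
    have "continuous_map T euclidean (\<lambda>x. a x * b x)"
      using a b by (simp add: continuous_map_atin tendsto_mult)
    then show "a \<otimes>\<^bsub>C_alg T\<^esub> b \<in> carrier (C_alg T)"
      using restrict by (simp add: C_alg_def)
    have "continuous_map T euclidean (\<lambda>x. a x + b x)"
      using a b by (rule continuous_map_add)
    then show "a \<oplus>\<^bsub>C_alg T\<^esub> b \<in> carrier (C_alg T)"
      using restrict by (simp add: C_alg_def)
  }
  have "continuous_map T euclidean (\<lambda>x. c * a x)"
    using a by (simp add: continuous_map_atin tendsto_mult)
  then show "c \<odot>\<^bsub>C_alg T\<^esub> a \<in> carrier (C_alg T)"
    using restrict by (simp add: C_alg_def)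
  have "continuous_map T euclidean (\<lambda>x. cnj (a x))"
    using a by (simp add: continuous_map_atin tendsto_cnj)
  then show "adj (C_alg T) a \<in> carrier (C_alg T)"
    using restrict by (simp add: C_alg_def)
qed

lemma C_alg_one_closed: "\<one>\<^bsub>C_alg T\<^esub> \<in> carrier (C_alg T)"
  by (auto simp: C_alg_def intro: continuous_map_eq[of _ _ "\<lambda>x. 1"])

lemma pair_rep_in_star_reps:
  assumes uv: "u \<in> topspace T" "v \<in> topspace T"
  shows "pair_rep T \<theta> u v \<in> star_reps T 2"
proof -
  let ?m = "\<lambda>a. mat 2 2 (\<lambda>(i, j). pair_rep T \<theta> u v a i j)"
  have "?m \<in> Ring.ring_hom (C_alg T) (L_alg 2)"
  proof (rule ring_hom_memI)
    fix a b assume ab: "a \<in> carrier (C_alg T)" "b \<in> carrier (C_alg T)"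
    show "?m (a \<otimes>\<^bsub>C_alg T\<^esub> b) = ?m a \<otimes>\<^bsub>L_alg 2\<^esub> ?m b"
    proof (rule eq_matI)
      fix i j assume "i < dim_row (?m a \<otimes>\<^bsub>L_alg 2\<^esub> ?m b)" "j < dim_col (?m a \<otimes>\<^bsub>L_alg 2\<^esub> ?m b)"
      then have ij: "i < 2" "j < 2" by (auto simp: L_alg_def)
      let ?p = "line_proj \<theta>" and ?d = "\<lambda>i j. if i = j then 1 else 0 :: complex"
      have "(?m a \<otimes>\<^bsub>L_alg 2\<^esub> ?m b) $$ (i, j) =
          (\<Sum>k\<in>{0, 1}. pair_rep T \<theta> u v a i k * pair_rep T \<theta> u v b k j)"
        using ij by (simp add: L_alg_def scalar_prod_def numeral_2_eq_2)
      \<comment> \<open>Writing P for the projection, the mixed terms carry the coefficient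
        \<open>P - P^2\<close>, which vanishes by idempotence.\<close>
      also have "\<dots> = a u * b u * (?p i 0 * ?p 0 j + ?p i 1 * ?p 1 j)
          + a u * b v * (?p i j - (?p i 0 * ?p 0 j + ?p i 1 * ?p 1 j))
          + a v * b u * (?p i j - (?p i 0 * ?p 0 j + ?p i 1 * ?p 1 j))
          + a v * b v * (?d i j - 2 * ?p i j + (?p i 0 * ?p 0 j + ?p i 1 * ?p 1 j))"
        using ij ab unfolding less_2_cases_iff
        by (elim disjE) (simp_all add: pair_rep_def algebra_simps)
      also have "\<dots> = (a u * b u) * ?p i j + (a v * b v) * (?d i j - ?p i j)"
        unfolding line_proj_idem[OF ij] by (simp add: algebra_simps)
      also have "\<dots> = ?m (a \<otimes>\<^bsub>C_alg T\<^esub> b) $$ (i, j)"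
        using ij uv C_alg_closed(1)[OF ab] by (simp add: C_alg_def pair_rep_def)
      finally show "?m (a \<otimes>\<^bsub>C_alg T\<^esub> b) $$ (i, j) = (?m a \<otimes>\<^bsub>L_alg 2\<^esub> ?m b) $$ (i, j)" ..
    qed (auto simp: L_alg_def)
    show "?m (a \<oplus>\<^bsub>C_alg T\<^esub> b) = ?m a \<oplus>\<^bsub>L_alg 2\<^esub> ?m b"
      using C_alg_closed(2)[OF ab] ab uv
      by (intro eq_matI) (auto simp: L_alg_def C_alg_def pair_rep_def algebra_simps)
  next
    show "?m \<one>\<^bsub>C_alg T\<^esub> = \<one>\<^bsub>L_alg 2\<^esub>"
      using C_alg_one_closed[of T] uv by (intro eq_matI) (auto simp: L_alg_def C_alg_def pair_rep_def)
  qed (simp add: L_alg_def)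
  moreover have "?m (c \<odot>\<^bsub>C_alg T\<^esub> a) = c \<odot>\<^bsub>L_alg 2\<^esub> ?m a" if "a \<in> carrier (C_alg T)" for a c
    using C_alg_closed(3)[OF that] that uv
    by (intro eq_matI) (auto simp: L_alg_def C_alg_def pair_rep_def algebra_simps)
  moreover have "?m (adj (C_alg T) a) = adj (L_alg 2) (?m a)" if "a \<in> carrier (C_alg T)" for a
    using C_alg_closed(4)[OF that] that uv
    by (intro eq_matI) (auto simp: L_alg_def C_alg_def pair_rep_def line_proj_def mat_adjoint_def
        mat_of_rows_index algebra_simps)
  ultimately show ?thesis
    by (simp add: star_reps_def unital_star_hom_def)
qed

text \<open>The labels pass through \<open>g\<close> so that points of the projective plane can be
  handled by unit vectors representing them.\<close>

lemma continuous_on_pair_rep: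
  assumes g: "continuous_map X T g"
    and \<theta>: "continuous_on (S :: 'b::t2_space set) \<theta>"
    and x: "continuous_map (top_of_set S) X x" and y: "continuous_map (top_of_set S) X y"
  shows "continuous_on S (\<lambda>s. pair_rep T (\<theta> s) (g (x s)) (g (y s)))"
proof (intro continuous_on_coordinatewise_then_product)
  fix a i j
  have "continuous_on S (\<lambda>s. a (g (z s)))"
    if "a \<in> carrier (C_alg T)" "continuous_map (top_of_set S) X z" for z
    using continuous_map_compose[OF continuous_map_compose[OF that(2) g], of euclidean a] that(1)
    by (simp add: C_alg_carrier_iff comp_def)
  moreover have "continuous_on S (\<lambda>s. line_proj (\<theta> s) i j)"
    unfolding line_proj_def by (cases "i = 0"; cases "j = 0") (auto intro!: continuous_intros \<theta>)
  ultimately show "continuous_on S (\<lambda>s. pair_rep T (\<theta> s) (g (x s)) (g (y s)) a i j)"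
    using x y unfolding pair_rep_def
    by (cases "a \<in> carrier (C_alg T)"; cases "i < 2"; cases "j < 2") (simp_all add: continuous_intros)
qed


section \<open>Lifting paths from the projective plane to the sphere\<close>

lemma topspace_S2 [simp]: "topspace S2 = sphere 0 1"
  by (simp add: S2_def)

lemma antipodal_class_eq_iff: "antipodal_class x = antipodal_class y \<longleftrightarrow> x = y \<or> x = - y"
  by (auto simp: antipodal_class_def doubleton_eq_iff)

text \<open>Guarantees that a sum over an antipodal class has two summands.\<close>

lemma unit_neq_minus:
  fixes x :: "'a::real_normed_vector"
  assumes "norm x = 1"
  shows "x \<noteq> - x"
proof
  assume "x = - x"
  then have "2 *\<^sub>R x = 0" by (simp add: scaleR_2 eq_neg_iff_add_eq_0)
  then show False using assms by simp
qed

text \<open>This is twice the orthogonal projection of \<open>y\<close> onto the line of the class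
  \<open>C\<close>. Where it is nonzero, normalizing it selects a representative of \<open>C\<close>
  continuously.\<close>

lemma continuous_map_RP2_line_component:
  "continuous_map RP2 euclidean (\<lambda>C. \<Sum>x\<in>C. inner x y *\<^sub>R x)"
proof (rule continuous_compose_quotient_map[OF quotient_map_RP2])
  have "(\<Sum>z\<in>antipodal_class x. inner z y *\<^sub>R z) = 2 *\<^sub>R inner x y *\<^sub>R x" if "x \<in> sphere 0 1" for x
  proof -
    have "x \<noteq> - x" using that by (intro unit_neq_minus) simp
    then show ?thesis unfolding scaleR_2 by (simp add: antipodal_class_def)
  qed
  moreover have "continuous_on (sphere 0 1) (\<lambda>x :: real ^ 3. 2 *\<^sub>R inner x y *\<^sub>R x)"
    by (intro continuous_intros)
  ultimately show "continuous_map S2 euclidean ((\<lambda>C. \<Sum>x\<in>C. inner x y *\<^sub>R x) \<circ> antipodal_class)"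
    unfolding S2_def by (auto intro: continuous_on_eq)
qed

text \<open>Lifts exist on short intervals around each point, and lifts on adjacent intervals can be
  glued after a change of sign; Bolzano's subdivision principle does the rest.\<close>

lemma path_lift_RP2:
  fixes g :: "real \<Rightarrow> (real ^ 3) set"
  assumes g: "continuous_map euclidean RP2 g" and "a \<le> b"
  shows "\<exists>L. continuous_on {a..b} L \<and> (\<forall>t\<in>{a..b}. norm (L t) = 1 \<and> antipodal_class (L t) = g t)"
  using \<open>a \<le> b\<close>
proof (induction rule: Bolzano)
  case (trans a b c)
  then obtain L M where
    L: "continuous_on {a..b} L" "\<forall>t\<in>{a..b}. norm (L t) = 1 \<and> antipodal_class (L t) = g t" and
    M: "continuous_on {b..c} M" "\<forall>t\<in>{b..c}. norm (M t) = 1 \<and> antipodal_class (M t) = g t"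
    by blast
  have "antipodal_class (L b) = antipodal_class (M b)" using L M trans by simp
  then obtain \<epsilon> :: real where \<epsilon>: "\<epsilon> = 1 \<or> \<epsilon> = -1" "L b = \<epsilon> *\<^sub>R M b"
    by (metis antipodal_class_eq_iff scaleR_minus1_left scaleR_one)
  have "continuous_on ({a..b} \<union> {b..c}) (\<lambda>t. if t \<le> b then L t else \<epsilon> *\<^sub>R M t)"
    by (rule continuous_on_If) (use L M \<epsilon> in \<open>auto intro!: continuous_intros dest: antisym\<close>)
  moreover have "{a..b} \<union> {b..c} = {a..c}" using trans by auto
  moreover have "antipodal_class (\<epsilon> *\<^sub>R M t) = antipodal_class (M t)" for t
    using \<epsilon>(1) by (auto simp: antipodal_class_eq_iff)
  ultimately show ?case using L M \<epsilon>(1)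
    by (intro exI[of _ "\<lambda>t. if t \<le> b then L t else \<epsilon> *\<^sub>R M t"]) auto
next
  case (local x)
  have rep: "\<exists>z. norm z = 1 \<and> g t = antipodal_class z" for t
  proof -
    have "g t \<in> topspace RP2" using continuous_map_image_subset_topspace[OF g] by auto
    then show ?thesis by (auto simp: topspace_RP2)
  qed
  obtain y where y: "norm y = 1" "g x = antipodal_class y" using rep by blast
  define q where "q t = (\<Sum>z\<in>g t. inner z y *\<^sub>R z)" for t
  have q: "q t = 2 *\<^sub>R inner z y *\<^sub>R z" if "norm z = 1" "g t = antipodal_class z" for t z
  proof -
    have "z \<noteq> - z" using that by (intro unit_neq_minus)
    then show ?thesis unfolding scaleR_2 by (simp add: q_def that antipodal_class_def)
  qed
  \<comment> \<open>By continuity \<open>q\<close> stays nonzero near \<open>x\<close>, since there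
    it equals twice the unit vector \<open>y\<close>; its direction is the local lift.\<close>
  have cq: "continuous_on UNIV q"
    using continuous_map_compose[OF g continuous_map_RP2_line_component[of y]]
    by (simp add: q_def[abs_def] comp_def)
  have "q x \<noteq> 0" using q[OF y] y by (auto simp: dot_square_norm)
  then obtain d where d: "d > 0" "\<And>t. dist t x < d \<Longrightarrow> q t \<noteq> 0"
    using continuous_at_avoid[of x q 0] cq by (auto simp: continuous_on_eq_continuous_at dist_commute)
  have "continuous_on {a..b} (\<lambda>t. sgn (q t)) \<and>
      (\<forall>t\<in>{a..b}. norm (sgn (q t)) = 1 \<and> antipodal_class (sgn (q t)) = g t)"
    if ab: "a \<le> x" "x \<le> b" "b - a < d" for a b
  proof -
    have nz: "q t \<noteq> 0" if "t \<in> {a..b}" for t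
      by (rule d(2)) (use that ab in \<open>auto simp: dist_real_def abs_real_def\<close>)
    have "antipodal_class (sgn (q t)) = g t" if t: "t \<in> {a..b}" for t
    proof -
      obtain z where z: "norm z = 1" "g t = antipodal_class z" using rep by blast
      have "inner z y \<noteq> 0" using q[OF z] nz[OF t] by auto
      then have "sgn (q t) = z \<or> sgn (q t) = - z"
        unfolding q[OF z] by (cases "inner z y > 0") (auto simp: sgn_scaleR sgn_div_norm z)
      then show ?thesis by (auto simp: z antipodal_class_eq_iff)
    qed
    moreover have "continuous_on {a..b} (\<lambda>t. sgn (q t))"
      using nz by (intro continuous_on_sgn continuous_on_subset[OF cq]) auto
    ultimately show ?thesis using nz by (auto simp: norm_sgn)
  qed
  with d(1) show ?case by blast
qed


section \<open>Loops in the projective plane\<close>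

theorem corollary3p3:
  fixes f :: "complex \<Rightarrow> (real ^ 3) set"
  assumes "loop_in RP2 f"
  shows "quantum_nullhomotopic RP2 f"
proof -
  let ?I = "{0..1} :: real set" and ?S = "sphere 0 1 :: (real ^ 3) set"
  let ?K = "star_reps RP2 2" and ?c = antipodal_class
  define R where "R \<theta> x y = pair_rep RP2 \<theta> (?c x) (?c y)" for \<theta> x y
  have R_in: "R \<theta> x y \<in> ?K" if "x \<in> ?S" "y \<in> ?S" for \<theta> x y
    using that by (auto simp: R_def topspace_RP2 intro!: pair_rep_in_star_reps)
  have R_cont: "continuous_on A (\<lambda>s. R (\<theta> s) (x s) (y s))"
    if "continuous_on A \<theta>" "continuous_on A x" "continuous_on A y" "x \<in> A \<rightarrow> ?S" "y \<in> A \<rightarrow> ?S"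
    for A :: "'b::t2_space set" and \<theta> x y
    unfolding R_def using that
    by (intro continuous_on_pair_rep[OF quotient_imp_continuous_map[OF quotient_map_RP2]])
      (auto simp: S2_def)
  have "continuous_map euclidean S1 (\<lambda>t. cis (2 * pi * t))"
    by (auto simp: S1_def continuous_map_in_subtopology cis_conv_exp intro!: continuous_intros)
  then have "continuous_map euclidean RP2 (\<lambda>t. f (cis (2 * pi * t)))"
    using continuous_map_compose assms unfolding loop_in_def comp_def by blast
  from path_lift_RP2[OF this, of 0 1] obtain L where
    L: "continuous_on ?I L" "\<And>t. t \<in> ?I \<Longrightarrow> L t \<in> ?S"
      "\<And>t. t \<in> ?I \<Longrightarrow> ?c (L t) = f (cis (2 * pi * t))" by auto
  have c01: "?c (L 1) = ?c (L 0)" using L(3)[of 0] L(3)[of 1] by simp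
  then obtain \<epsilon> :: real where \<epsilon>: "\<epsilon> = 1 \<or> \<epsilon> = -1" "L 1 = \<epsilon> *\<^sub>R L 0"
    by (metis antipodal_class_eq_iff scaleR_minus1_left scaleR_one)
  define m where "m t = R 0 (L t) (L 0)" for t
  \<comment> \<open>The two parameters move the labels of the two lines independently. The diagonal
    of the square is the given scalar loop, and the lower edge is \<open>m\<close>.\<close>
  define k where "k = (\<lambda>(s, t). R 0 (L s) (L t))"
  have L_fst: "continuous_on (?I \<times> ?I) (\<lambda>z. L (fst z))"
    and L_snd: "continuous_on (?I \<times> ?I) (\<lambda>z. L (snd z))"
    by (rule continuous_on_compose2[OF L(1)]; auto intro: continuous_intros)+
  have k_cont: "continuous_on (?I \<times> ?I) k"
    unfolding k_def case_prod_beta using L(2) by (intro R_cont L_fst L_snd) auto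
  have k_in: "k \<in> ?I \<times> ?I \<rightarrow> ?K"
    using R_in L(2) by (auto simp: k_def)
  let ?d = "linepath (0::real, 0::real) (1::real, 1::real)"
  let ?e1 = "linepath (0::real, 0::real) (1::real, 0::real)"
  let ?e2 = "linepath (1::real, 0::real) (1, 1::real)"
  have k_d: "k (?d t) = scalar_rep RP2 2 (f (cis (2 * pi * t)))" if "t \<in> ?I" for t
    using L(3)[OF that] by (simp add: k_def linepath_def R_def pair_rep_same)
  have k_e1: "k \<circ> ?e1 = m"
    by (rule ext) (simp add: k_def linepath_def m_def)
  have k_e2: "k \<circ> ?e2 = (\<lambda>t. R 0 (L 0) (L t))"
    by (rule ext) (simp add: k_def linepath_def R_def c01)

  \<comment> \<open>The square is convex, so its diagonal deforms into the path along two edges;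
    \<open>k\<close> carries this to representations.\<close>
  have "homotopic_paths (?I \<times> ?I) ?d (?e1 +++ ?e2)"
  proof (rule homotopic_paths_linear)
    fix t :: real assume t: "t \<in> ?I"
    have "?d t \<in> ?I \<times> ?I" "(?e1 +++ ?e2) t \<in> ?I \<times> ?I"
      using t by (auto simp: linepath_def joinpaths_def)
    then show "closed_segment (?d t) ((?e1 +++ ?e2) t) \<subseteq> ?I \<times> ?I"
      by (intro closed_segment_subset convex_Times) auto
  qed auto
  from homotopic_paths_continuous_image[OF this k_cont k_in]
  have diag: "homotopic_paths ?K (k \<circ> ?d) (m +++ (\<lambda>t. R 0 (L 0) (L t)))"
    by (simp add: path_compose_join k_e1 k_e2)

  \<comment> \<open>A quarter turn swaps the two lines. At \<open>t = 0\<close> and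
    \<open>t = 1\<close> both labels are the base point, so the endpoints stay fixed
    throughout.\<close>
  have rotate: "homotopic_paths ?K (\<lambda>t. R 0 (L 0) (L t)) m"
    unfolding homotopic_paths
  proof (intro exI conjI ballI)
    let ?h = "\<lambda>z :: real \<times> real. R (fst z * pi / 2) (L 0) (L (snd z))"
    show "continuous_on (?I \<times> ?I) ?h"
      using L(2) by (intro R_cont L_snd) (auto intro!: continuous_intros)
    show "?h \<in> ?I \<times> ?I \<rightarrow> ?K"
      using R_in L(2) by auto
  qed (auto simp: R_def m_def pair_rep_quarter_turn pair_rep_same c01 pathstart_def pathfinish_def)
  have "path m"
    unfolding path_def m_def using L(2) by (intro R_cont L(1)) auto
  moreover have "path_image m \<subseteq> ?K"
    using R_in L(2) by (auto simp: path_image_def m_def)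
  ultimately have "homotopic_paths ?K (m +++ (\<lambda>t. R 0 (L 0) (L t))) (m +++ m)"
    by (intro homotopic_paths_join rotate)
      (auto simp: m_def R_def c01 pathstart_def pathfinish_def)
  from homotopic_paths_trans[OF diag this]
  have mm: "homotopic_loops ?K (k \<circ> ?d) (m +++ m)"
    by (rule homotopic_paths_imp_homotopic_loops)
      (auto simp: k_def m_def R_def c01 pathstart_def pathfinish_def joinpaths_def linepath_def)

  text \<open>\<^term>\<open>m +++ m\<close> lifts to a loop in the sphere even if \<^term>\<open>L\<close> is not closed.\<close>

  define M where "M = L +++ (\<lambda>t. \<epsilon> *\<^sub>R L t)"
  \<comment> \<open>With the second label held at the base point, a contraction of \<open>M\<close>
    in the sphere is carried by \<open>G\<close> to one of \<open>m +++ m\<close>.\<close>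
  define G where "G x = R 0 x (L 0)" for x
  have G: "continuous_on ?S G" "G \<in> ?S \<rightarrow> ?K"
  proof -
    show "continuous_on ?S G"
      unfolding G_def using L(2)[of 0] by (intro R_cont) (auto intro: continuous_intros)
    show "G \<in> ?S \<rightarrow> ?K"
      using R_in L(2)[of 0] by (auto simp: G_def)
  qed
  have GM: "G \<circ> M = m +++ m"
  proof -
    \<comment> \<open>\<open>G\<close> sees only antipodal classes, so both halves of
      \<open>M\<close> become \<open>m\<close>.\<close>
    have "?c (\<epsilon> *\<^sub>R L t) = ?c (L t)" for t
      using \<epsilon>(1) by (auto simp: antipodal_class_eq_iff)
    then have "G \<circ> L = m" "G \<circ> (\<lambda>t. \<epsilon> *\<^sub>R L t) = m"
      by (auto simp: G_def m_def R_def)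
    then show ?thesis by (simp add: M_def path_compose_join)
  qed
  have "path M"
    using L(1) \<epsilon> unfolding M_def
    by (intro path_join_imp) (auto simp: path_def pathstart_def pathfinish_def intro!: continuous_intros)
  moreover have "path_image M \<subseteq> ?S"
    using L(2) \<epsilon>(1) unfolding M_def by (intro subset_path_image_join) (auto simp: path_image_def)
  \<comment> \<open>The second half of \<open>M\<close> ends at
    \<open>\<epsilon> *\<^sub>R L 1\<close>, where the sign enters twice and cancels, giving
    \<open>L 0\<close>.\<close>
  moreover have "pathfinish M = pathstart M"
    using \<epsilon> by (auto simp: M_def pathstart_def pathfinish_def joinpaths_def)
  moreover have "simply_connected ?S"
    by (rule simply_connected_sphere) simp
  ultimately have "homotopic_loops ?S M (linepath (L 0) (L 0))"
    using L(2)[of 0] unfolding simply_connected_eq_contractible_loop_any by simp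
  from homotopic_loops_continuous_image[OF this G]
  have "homotopic_loops ?K (m +++ m) (\<lambda>_. G (L 0))"
    unfolding GM by (simp add: comp_def linepath_def algebra_simps flip: scaleR_add_left)
  with mm have "homotopic_loops ?K (k \<circ> ?d) (\<lambda>_. G (L 0))"
    by (rule homotopic_loops_trans)
  \<comment> \<open>The two loops are compared on the unit interval only, because \<open>L\<close>
    is known to lift the loop only there.\<close>
  moreover have "homotopic_loops ?K (\<lambda>t. scalar_rep RP2 2 (f (cis (2 * pi * t)))) (k \<circ> ?d)"
  proof (rule homotopic_loops_sym, rule homotopic_loops_eq)
    show "path (k \<circ> ?d)" "path_image (k \<circ> ?d) \<subseteq> ?K" "pathfinish (k \<circ> ?d) = pathstart (k \<circ> ?d)"
      using mm homotopic_loops_imp_path homotopic_loops_imp_subset homotopic_loops_imp_loop by blast+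
  qed (simp add: k_d)
  ultimately show ?thesis
    using assms by (intro quantum_nullhomotopicI[where n = 2]) (auto intro: homotopic_loops_trans)
qed

end
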